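(* Let $n \ge 1$ be an integer. If the game of size $n$ has a non-trivial kernel (that is, there exists a non-empty null sequence for the game of size $n$), then for every integer $j \ge 1$ the game of size $n + (n+2)j$ also has a non-trivial kernel.
   Context: For an integer $n\ge 1$, the (triangular Lights Out) game of size $n$ is played on a triangular arrangement of $\beta = n(n+1)/2$ circles ("buttons") with side length $n$: row $r$ ($1\le r\le n$, from top to bottom) contains $r$ buttons, and circles touch as in the usual triangular packing. In coordinates, the buttons are the pairs $(r,s)$ with $1\le s\le r\le n$, and the neighbors of $(r,s)$ (the circles tangent to it) are those among $(r,s-1),(r,s+1),(r-1,s-1),(r-1,s),(r+1,s),(r+1,s+1)$ that belong to the arrangement. Each button is either lit or unlit; a configuration is identified with the set $C$ of lit buttons. Pressing a button switches the state of that button and of all of its neighbors. Since the order of presses is irrelevant and pressing a button twice has no effect, a move is described by a set $X$ of buttons, each pressed once; $C \xrightarrow{X} D$ means that pressing the buttons of $X$ starting from configuration $C$ yields configuration $D$. A set of buttons $X$ is a null sequence if $C \xrightarrow{X} C$ for every configuration $C$ (equivalently, for every button $b$, the number of elements of $X$ that are equal to $b$ or are neighbors of $b$ is even). The kernel of the game is the set of all null sequences; it always contains $\emptyset$, and it is called non-trivial if it contains a non-empty set. *)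

theory Defs
  imports Main
begin

definition buttons :: "nat \<Rightarrow> (nat \<times> nat) set" where
  "buttons n = {(r, s). 1 \<le> s \<and> s \<le> r \<and> r \<le> n}"

text \<open>
  For a button \<open>(r, s)\<close> we have \<open>r, s \<ge> 1\<close>, so the subtractions are not truncated.
\<close>

fun neighbors :: "nat \<Rightarrow> nat \<times> nat \<Rightarrow> (nat \<times> nat) set" where
  "neighbors n (r, s) =
     {(r, s - 1), (r, s + 1), (r - 1, s - 1), (r - 1, s), (r + 1, s), (r + 1, s + 1)} \<inter> buttons n"

definition press :: "nat \<Rightarrow> nat \<times> nat \<Rightarrow> (nat \<times> nat) set \<Rightarrow> (nat \<times> nat) set" where
  "press n b C = sym_diff C (insert b (neighbors n b))"

text \<open>
  The fold is meaningful because presses commute (\<open>comp_fun_commute_press\<close>)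
  and sets of buttons are finite (\<open>finite_buttons\<close>).
\<close>

definition press_all :: "nat \<Rightarrow> (nat \<times> nat) set \<Rightarrow> (nat \<times> nat) set \<Rightarrow> (nat \<times> nat) set" where
  "press_all n X C = Finite_Set.fold (press n) C X"

definition null_sequence :: "nat \<Rightarrow> (nat \<times> nat) set \<Rightarrow> bool" where
  "null_sequence n X \<longleftrightarrow> X \<subseteq> buttons n \<and> (\<forall>C. C \<subseteq> buttons n \<longrightarrow> press_all n X C = C)"

definition kernel :: "nat \<Rightarrow> (nat \<times> nat) set set" where
  "kernel n = {X. null_sequence n X}"

definition nontrivial_kernel :: "nat \<Rightarrow> bool" where
  "nontrivial_kernel n \<longleftrightarrow> (\<exists>X \<in> kernel n. X \<noteq> {})"

lemma finite_buttons: "finite (buttons n)"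
  by (rule finite_subset[of _ "{..n} \<times> {..n}"]) (auto simp: buttons_def)

lemma comp_fun_commute_press: "comp_fun_commute (press n)"
  by standard (auto simp: press_def fun_eq_iff)

lemma mem_neighbors_iff:
  assumes "(r, s) \<in> buttons n" "(r', s') \<in> buttons n"
  shows "(r', s') \<in> neighbors n (r, s) \<longleftrightarrow>
    r' = r \<and> (s' + 1 = s \<or> s' = s + 1) \<or>
    r' + 1 = r \<and> (s' + 1 = s \<or> s' = s) \<or>
    r' = r + 1 \<and> (s' = s \<or> s' = s + 1)"
proof -
  have "(r', s') \<in> neighbors n (r, s) \<longleftrightarrow>
    (r', s') \<in> {(r, s - 1), (r, s + 1), (r - 1, s - 1), (r - 1, s), (r + 1, s), (r + 1, s + 1)}"
    using assms(2) by simp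
  moreover have "r' = r - 1 \<longleftrightarrow> r' + 1 = r" "s' = s - 1 \<longleftrightarrow> s' + 1 = s"
    using assms by (auto simp: buttons_def)
  ultimately show ?thesis by auto
qed

lemma neighbors_sym:
  assumes "b \<in> buttons n" "c \<in> buttons n"
  shows "b \<in> neighbors n c \<longleftrightarrow> c \<in> neighbors n b"
proof -
  obtain r s r' s' where bc: "b = (r, s)" "c = (r', s')" by (cases b; cases c)
  show ?thesis
    using assms unfolding bc by (subst (1 2) mem_neighbors_iff) auto
qed

lemma mem_press_all_iff:
  assumes "X \<subseteq> buttons n" "b \<in> buttons n"
  shows "b \<in> press_all n X C \<longleftrightarrow>
         (b \<in> C \<longleftrightarrow> even (card {x \<in> X. x = b \<or> x \<in> neighbors n b}))"
proof -
  interpret comp_fun_commute "press n" by (rule comp_fun_commute_press)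
  have "finite X" using assms(1) finite_buttons finite_subset by blast
  then show ?thesis using assms(1)
  proof (induction X)
    case empty
    then show ?case by (simp add: press_all_def)
  next
    case (insert a X)
    have fin: "finite {x \<in> X. x = b \<or> x \<in> neighbors n b}" using insert by simp
    have sym: "b \<in> neighbors n a \<longleftrightarrow> a \<in> neighbors n b"
      using insert.prems assms(2) neighbors_sym by simp
    have fold: "press_all n (insert a X) C = press n a (press_all n X C)"
      using insert by (simp add: press_all_def)
    show ?case
    proof (cases "a = b \<or> a \<in> neighbors n b")
      case True
      then have "{x \<in> insert a X. x = b \<or> x \<in> neighbors n b} =
                 insert a {x \<in> X. x = b \<or> x \<in> neighbors n b}" by auto
      then show ?thesis using True insert fin sym fold by (auto simp: press_def)
    next
      case False
      then have "{x \<in> insert a X. x = b \<or> x \<in> neighbors n b} =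
                 {x \<in> X. x = b \<or> x \<in> neighbors n b}" by auto
      then show ?thesis using False insert sym fold by (auto simp: press_def)
    qed
  qed
qed

lemma press_all_subset:
  assumes "X \<subseteq> buttons n" "C \<subseteq> buttons n"
  shows "press_all n X C \<subseteq> buttons n"
proof -
  interpret comp_fun_commute "press n" by (rule comp_fun_commute_press)
  have "finite X" using assms(1) finite_buttons finite_subset by blast
  then show ?thesis using assms(1)
  proof (induction X)
    case empty
    then show ?case using assms(2) by (simp add: press_all_def)
  next
    case (insert a X)
    have "neighbors n a \<subseteq> buttons n" by (cases a) auto
    then show ?case using insert by (auto simp: press_all_def press_def)
  qed
qed

lemma null_sequence_iff_even:
  "null_sequence n X \<longleftrightarrow> X \<subseteq> buttons n \<and>
     (\<forall>b \<in> buttons n. even (card {x \<in> X. x = b \<or> x \<in> neighbors n b}))"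
  (is "_ \<longleftrightarrow> _ \<and> ?E")
proof (cases "X \<subseteq> buttons n")
  case True
  have "?E" if "null_sequence n X"
    using that mem_press_all_iff[OF True, where C = "{}"] by (auto simp: null_sequence_def)
  moreover have "press_all n X C = C" if ?E "C \<subseteq> buttons n" for C
    using that mem_press_all_iff[OF True] press_all_subset[OF True] by blast
  ultimately show ?thesis using True by (auto simp: null_sequence_def)
qed (simp add: null_sequence_def)

end

(*
  Surround the triangle by the three lines of lattice points next to its sides, where no button is
  pressed; they bound a triangle of side length L = n + 2.  Repeatedly reflecting a null sequence
  across these lines gives a periodic pattern on the whole triangular lattice.  It is again null:
  the neighbors of a point on a mirror lie on mirrors or come in mirror pairs.  The mirrors
  contain the sides of a triangle of side length L * (j + 1) = (n + (n + 2) * j) + 2, so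
  the restriction of the pattern to that triangle is a null sequence.
*)
theory Submission
  imports Defs
begin

section \<open>Null sequences as patterns on a triangle of lattice points\<close>

text \<open>
  The lattice point \<open>(p, s)\<close> stands for the button \<open>(p - 1, s)\<close>. The shift puts a vertex of the
  surrounding triangle \<open>0 \<le> s \<le> p \<le> L\<close> at the origin; its barycentric coordinates are
  \<open>(L - p, p - s, s)\<close>.
\<close>

definition balanced :: "(int \<Rightarrow> int \<Rightarrow> bool) \<Rightarrow> int \<Rightarrow> int \<Rightarrow> bool" where
  "balanced f p s \<longleftrightarrow>
     even (of_bool (f p s) + of_bool (f p (s - 1)) + of_bool (f p (s + 1)) +
           of_bool (f (p - 1) (s - 1)) + of_bool (f (p - 1) s) +
           of_bool (f (p + 1) s) + of_bool (f (p + 1) (s + 1)) :: nat)"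

text \<open>Only the values of \<open>f\<close> on the closed triangle enter, so a pattern on the
  whole lattice can be used without restricting it.\<close>

definition null_pattern :: "int \<Rightarrow> (int \<Rightarrow> int \<Rightarrow> bool) \<Rightarrow> bool" where
  "null_pattern L f \<longleftrightarrow>
     (\<forall>t. 0 \<le> t \<longrightarrow> t \<le> L \<longrightarrow> \<not> f t 0 \<and> \<not> f t t \<and> \<not> f L t) \<and>
     (\<forall>p s. 0 < s \<longrightarrow> s < p \<longrightarrow> p < L \<longrightarrow> balanced f p s)"

lemma null_patternD:
  assumes "null_pattern L f"
  shows "0 \<le> t \<Longrightarrow> t \<le> L \<Longrightarrow> \<not> f t 0"
    and "0 \<le> t \<Longrightarrow> t \<le> L \<Longrightarrow> \<not> f t t"
    and "0 \<le> t \<Longrightarrow> t \<le> L \<Longrightarrow> \<not> f L t"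
    and "0 < s \<Longrightarrow> s < p \<Longrightarrow> p < L \<Longrightarrow> balanced f p s"
  using assms unfolding null_pattern_def by blast+

lemma length_filter_eq_sum_list: "length (filter P xs) = (\<Sum>x\<leftarrow>xs. of_bool (P x))"
  by (induction xs) auto

text \<open>Listed points that are not buttons lie on the sides of the surrounding triangle, where
  \<open>f\<close> is false, so \<open>X\<close> and \<open>f\<close> agree at all seven points. As
  \<open>1 \<le> s\<close>, truncated subtraction does not make two of them coincide.\<close>

lemma even_card_presses_iff_balanced:
  assumes b: "(r, s) \<in> buttons n"
    and X: "\<And>r s. (r, s) \<in> X \<longleftrightarrow> (r, s) \<in> buttons n \<and> f (int r + 1) (int s)"
    and f: "\<And>t. 0 \<le> t \<Longrightarrow> t \<le> int n + 2 \<Longrightarrow> \<not> f t 0 \<and> \<not> f t t \<and> \<not> f (int n + 2) t"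
  shows "even (card {x \<in> X. x = (r, s) \<or> x \<in> neighbors n (r, s)}) \<longleftrightarrow>
    balanced f (int r + 1) (int s)"
proof -
  let ?N = "[(r, s), (r, s - 1), (r, s + 1), (r - 1, s - 1), (r - 1, s), (r + 1, s), (r + 1, s + 1)]"
  have rs: "1 \<le> s" "s \<le> r" "r \<le> n" using b by (auto simp: buttons_def)
  have d: "distinct ?N" using rs by auto
  have "X \<subseteq> buttons n" using X by auto
  then have "{x \<in> X. x = (r, s) \<or> x \<in> neighbors n (r, s)} = set (filter (\<lambda>x. x \<in> X) ?N)"
    unfolding neighbors.simps set_filter list.set by blast
  moreover have "card (set (filter (\<lambda>x. x \<in> X) ?N)) = length (filter (\<lambda>x. x \<in> X) ?N)"
    by (intro distinct_card distinct_filter d)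
  ultimately have card: "card {x \<in> X. x = (r, s) \<or> x \<in> neighbors n (r, s)} =
      (\<Sum>x\<leftarrow>?N. of_bool (x \<in> X))"
    by (simp only: length_filter_eq_sum_list)
  have *: "(r', s') \<in> X \<longleftrightarrow> f p t"
    if "p = int r' + 1" "t = int s'" "0 \<le> t" "t \<le> p" "p \<le> int n + 2" for r' s' p t
  proof (cases "t = 0 \<or> t = p \<or> p = int n + 2")
    case True
    then have "\<not> f p t"
      using that(3-5) f[of p] f[of t] by (elim disjE) simp_all
    moreover have "(r', s') \<notin> X"
      using True that X[of r' s'] by (auto simp: buttons_def)
    ultimately show ?thesis by simp
  next
    case False
    then show ?thesis using that X[of r' s'] by (auto simp: buttons_def)
  qed
  have mem:
    "(r, s) \<in> X \<longleftrightarrow> f (int r + 1) (int s)"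
    "(r, s - 1) \<in> X \<longleftrightarrow> f (int r + 1) (int s - 1)"
    "(r, s + 1) \<in> X \<longleftrightarrow> f (int r + 1) (int s + 1)"
    "(r - 1, s - 1) \<in> X \<longleftrightarrow> f (int r) (int s - 1)"
    "(r - 1, s) \<in> X \<longleftrightarrow> f (int r) (int s)"
    "(r + 1, s) \<in> X \<longleftrightarrow> f (int r + 2) (int s)"
    "(r + 1, s + 1) \<in> X \<longleftrightarrow> f (int r + 2) (int s + 1)"
    using rs by (intro *; simp add: of_nat_diff)+
  have shift: "int r + 1 - 1 = int r" "int r + 1 + 1 = int r + 2" by simp_all
  show ?thesis
    unfolding card balanced_def shift list.map sum_list.Cons sum_list.Nil mem
    by (simp only: add.assoc add_0_right)
qed

lemma nontrivial_kernel_iff_null_pattern: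
  "nontrivial_kernel n \<longleftrightarrow>
    (\<exists>f. null_pattern (int n + 2) f \<and> (\<exists>p s. 0 < s \<and> s < p \<and> p < int n + 2 \<and> f p s))"
  (is "_ \<longleftrightarrow> ?R")
proof
  assume "nontrivial_kernel n"
  then obtain X where X: "null_sequence n X" "X \<noteq> {}"
    by (auto simp: nontrivial_kernel_def kernel_def)
  define f where
    "f p s \<longleftrightarrow> 0 < s \<and> s < p \<and> p < int n + 2 \<and> (nat (p - 1), nat s) \<in> X" for p s
  have sub: "X \<subseteq> buttons n"
    and even: "\<And>b. b \<in> buttons n \<Longrightarrow> even (card {x \<in> X. x = b \<or> x \<in> neighbors n b})"
    using X(1) by (auto simp: null_sequence_iff_even)
  have mem: "(r, s) \<in> X \<longleftrightarrow> (r, s) \<in> buttons n \<and> f (int r + 1) (int s)" for r s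
    using sub by (auto simp: f_def buttons_def)
  have bd: "\<not> f t 0 \<and> \<not> f t t \<and> \<not> f (int n + 2) t" for t
    by (simp add: f_def)
  have "balanced f p s" if "0 < s" "s < p" "p < int n + 2" for p s
  proof -
    have "(nat (p - 1), nat s) \<in> buttons n" using that by (auto simp: buttons_def)
    then show ?thesis
      using even_card_presses_iff_balanced[OF _ mem bd] even that by fastforce
  qed
  then have "null_pattern (int n + 2) f" using bd by (simp add: null_pattern_def)
  moreover obtain r s where "(r, s) \<in> X" using X(2) by auto
  then have "0 < int s" "int s < int r + 1" "int r + 1 < int n + 2" "f (int r + 1) (int s)"
    using sub mem by (auto simp: buttons_def)
  ultimately show ?R by blast
next
  assume ?R
  then obtain f p s where f: "null_pattern (int n + 2) f"
    and ps: "0 < s" "s < p" "p < int n + 2" "f p s" by blast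
  define X where "X = {(r, s) \<in> buttons n. f (int r + 1) (int s)}"
  have mem: "(r, s) \<in> X \<longleftrightarrow> (r, s) \<in> buttons n \<and> f (int r + 1) (int s)" for r s
    by (auto simp: X_def)
  have "balanced f (int r + 1) (int s)" if "(r, s) \<in> buttons n" for r s
    using that by (intro null_patternD(4)[OF f]) (auto simp: buttons_def)
  then have "null_sequence n X"
    using even_card_presses_iff_balanced[OF _ mem] null_patternD(1-3)[OF f]
    by (auto simp: null_sequence_iff_even X_def)
  moreover have "(nat (p - 1), nat s) \<in> X"
    using ps by (auto simp: X_def buttons_def)
  ultimately show "nontrivial_kernel n"
    by (auto simp: nontrivial_kernel_def kernel_def)
qed

section \<open>Rotations of the triangle\<close>

definition rotate_pattern :: "int \<Rightarrow> (int \<Rightarrow> int \<Rightarrow> bool) \<Rightarrow> int \<Rightarrow> int \<Rightarrow> bool" where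
  "rotate_pattern L f p s = f (L - s) (p - s)"

lemma rotate_pattern_thrice: "rotate_pattern L (rotate_pattern L (rotate_pattern L f)) = f"
  by (simp add: rotate_pattern_def fun_eq_iff)

text \<open>The map from \<open>(p, s)\<close> to \<open>(L - s, p - s)\<close> permutes the
  barycentric coordinates cyclically, hence also the sides and the neighbor directions.\<close>

lemma null_pattern_rotate:
  assumes "null_pattern L f"
  shows "null_pattern L (rotate_pattern L f)"
proof -
  have "balanced (rotate_pattern L f) p s" if "0 < s" "s < p" "p < L" for p s
  proof -
    have "balanced f (L - s) (p - s)"
      using that by (intro null_patternD(4)[OF assms]) auto
    then show ?thesis
      unfolding balanced_def rotate_pattern_def by (simp add: algebra_simps)
  qed
  then show ?thesis
    using null_patternD(1-3)[OF assms] by (auto simp: null_pattern_def rotate_pattern_def)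
qed

text \<open>The index is a colour; \<open>k mod 3\<close> is nonnegative for negative
  \<open>k\<close> too, so the successor law holds for all integers.\<close>

definition rotated :: "int \<Rightarrow> (int \<Rightarrow> int \<Rightarrow> bool) \<Rightarrow> int \<Rightarrow> int \<Rightarrow> int \<Rightarrow> bool" where
  "rotated L f k = (rotate_pattern L ^^ nat (k mod 3)) f"

lemma rotated_0: "rotated L f 0 = f"
  by (simp add: rotated_def)

lemma rotated_succ: "rotated L f (k + 1) = rotate_pattern L (rotated L f k)"
proof -
  have "k mod 3 = 0 \<or> k mod 3 = 1 \<or> k mod 3 = 2" by presburger
  then show ?thesis
  proof (elim disjE)
    assume k: "k mod 3 = 0"
    then have "(k + 1) mod 3 = 1" by presburger
    with k show ?thesis by (simp add: rotated_def)
  next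
    assume k: "k mod 3 = 1"
    then have "(k + 1) mod 3 = 2" by presburger
    with k show ?thesis by (simp add: rotated_def numeral_2_eq_2)
  next
    assume k: "k mod 3 = 2"
    then have "(k + 1) mod 3 = 0" by presburger
    with k show ?thesis by (simp add: rotated_def rotate_pattern_thrice numeral_2_eq_2)
  qed
qed

lemma null_pattern_rotated:
  assumes "null_pattern L f"
  shows "null_pattern L (rotated L f k)"
proof -
  have "null_pattern L ((rotate_pattern L ^^ m) f)" for m
    using assms by (induction m) (auto intro: null_pattern_rotate)
  then show ?thesis by (simp add: rotated_def)
qed

section \<open>Unfolding by reflections\<close>

text \<open>
  The mirrors through the points of \<open>L \<int>\<^sup>2\<close> cut the lattice into rhombi, each consisting of two
  triangles. Colour \<open>(i L, k L)\<close> by \<open>i + k\<close> modulo 3; then every triangle has vertices of all three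
  colours, and the folding onto the original triangle is the affine map that respects colours.
  Within a rhombus it is the reflection at the long diagonal (\<open>max\<close> and \<open>min\<close>), followed by
  a rotation that depends on the colour of the corner.
\<close>

definition unfold_pattern :: "int \<Rightarrow> (int \<Rightarrow> int \<Rightarrow> bool) \<Rightarrow> int \<Rightarrow> int \<Rightarrow> bool" where
  "unfold_pattern L f p s =
     rotated L f (p div L + s div L) (max (p mod L) (s mod L)) (min (p mod L) (s mod L))"

context
  fixes L :: int and f :: "int \<Rightarrow> int \<Rightarrow> bool"
  assumes L: "L > 0" and f: "null_pattern L f"
begin

lemma unfold_pattern_mirror:
  "L dvd p \<or> L dvd s \<or> p mod L = s mod L \<Longrightarrow> \<not> unfold_pattern L f p s"
  using L null_patternD(1,2)[OF null_pattern_rotated[OF f]]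
  by (auto simp: unfold_pattern_def max_def min_def dvd_eq_mod_eq_0 less_imp_le
    dest: order_antisym)

text \<open>Steps to neighbors may end on the far sides \<open>p = L\<close> and
  \<open>s = L\<close>, where \<open>div\<close> already passes to the next rhombus. Both values are
  false there.\<close>

lemma unfold_pattern_rhombus:
  assumes "0 \<le> p" "p \<le> L" "0 \<le> s" "s \<le> L"
  shows "unfold_pattern L f (i * L + p) (k * L + s) = rotated L f (i + k) (max p s) (min p s)"
proof (cases "p = L \<or> s = L")
  case True
  then have "\<not> unfold_pattern L f (i * L + p) (k * L + s)"
    by (intro unfold_pattern_mirror) auto
  moreover have "\<not> rotated L f (i + k) (max p s) (min p s)"
    using True assms null_patternD(3)[OF null_pattern_rotated[OF f], of _ "i + k"]
    by (auto simp: max_def min_def)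
  ultimately show ?thesis by simp
next
  case False
  then show ?thesis using assms L by (simp add: unfold_pattern_def)
qed

lemma balanced_unfold_pattern: "balanced (unfold_pattern L f) x y"
proof -
  define i k p s where ik: "i = x div L" "k = y div L" and ps: "p = x mod L" "s = y mod L"
  have xy: "x = i * L + p" "y = k * L + s" by (simp_all add: ik ps)
  have rng: "0 \<le> p" "p < L" "0 \<le> s" "s < L" using L by (simp_all add: ps)
  let ?U = "unfold_pattern L f" and ?h = "rotated L f (i + k)"
  note h = null_patternD[OF null_pattern_rotated[OF f]]
  have U: "?U (x + a) (y + b) = ?h (max (p + a) (s + b)) (min (p + a) (s + b))"
    if "0 \<le> p + a" "p + a \<le> L" "0 \<le> s + b" "s + b \<le> L" for a b
    using unfold_pattern_rhombus[OF that, of i k] by (simp add: xy algebra_simps)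
  note mirror = unfold_pattern_mirror
  consider "p = 0" "s = 0" | "p = 0" "s > 0" | "p > 0" "s = 0" | "p > 0" "p = s"
    | "0 < s" "s < p" | "0 < p" "p < s"
    using rng by linarith
  then show ?thesis
  proof cases
    case 1
    \<comment> \<open>At a corner of a rhombus all neighbors lie on mirrors; the congruences handle
      the two on the diagonal.\<close>
    have d: "L dvd x" "L dvd y" using 1 by (simp_all add: xy)
    moreover have "(x + a) mod L = (y + a) mod L" for a
      using d by (metis dvd_imp_mod_0 mod_add_left_eq)
    from this[of 1] this[of "-1"] have "(x + 1) mod L = (y + 1) mod L" "(x - 1) mod L = (y - 1) mod L"
      by simp_all
    ultimately show ?thesis using mirror by (simp add: balanced_def)
  next
    case 2
    have d: "L dvd x" using 2 by (simp add: xy)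
    \<comment> \<open>The rhombus across the mirror has colour one less. The rotation matches its
      side \<open>p = L\<close> with the side \<open>s = 0\<close> here, so mirror images have equal
      values.\<close>
    have R: "?h = rotate_pattern L (rotated L f (i - 1 + k))"
      using rotated_succ[of L f "i - 1 + k"] by (simp add: algebra_simps)
    have left: "?U (x - 1) (y + b) = rotated L f (i - 1 + k) (L - 1) (s + b)"
      if "0 \<le> s + b" "s + b < L" for b
      using unfold_pattern_rhombus[of "L - 1" "s + b" "i - 1" k] that L 2
      by (simp add: xy algebra_simps)
    have "?U (x + 1) y = ?U (x - 1) (y - 1)"
      using U[of 1 0] left[of "-1"] 2 rng R by (simp add: rotate_pattern_def)
    moreover have "?U (x + 1) (y + 1) = ?U (x - 1) y"
      using U[of 1 1] left[of 0] 2 rng R by (simp add: rotate_pattern_def)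
    ultimately show ?thesis using mirror d by (simp add: balanced_def)
  next
    case 3
    have d: "L dvd y" using 3 by (simp add: xy)
    have R: "?h = rotate_pattern L (rotated L f (i + (k - 1)))"
      using rotated_succ[of L f "i + (k - 1)"] by (simp add: algebra_simps)
    have below: "?U (x + a) (y - 1) = rotated L f (i + (k - 1)) (L - 1) (p + a)"
      if "0 \<le> p + a" "p + a < L" for a
      using unfold_pattern_rhombus[of "p + a" "L - 1" i "k - 1"] that L 3
      by (simp add: xy algebra_simps)
    have "?U x (y + 1) = ?U (x - 1) (y - 1)"
      using U[of 0 1] below[of "-1"] 3 rng R by (simp add: rotate_pattern_def)
    moreover have "?U (x + 1) (y + 1) = ?U x (y - 1)"
      using U[of 1 1] below[of 0] 3 rng R by (simp add: rotate_pattern_def)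
    ultimately show ?thesis using mirror d by (simp add: balanced_def)
  next
    case 4
    \<comment> \<open>By the symmetry of \<open>max\<close> and \<open>min\<close>, the four
      neighbors off the diagonal cancel in pairs.\<close>
    have U': "?U (x + a) (y + b) = ?h (max (p + a) (p + b)) (min (p + a) (p + b))"
      if "-1 \<le> a" "a \<le> 1" "-1 \<le> b" "b \<le> 1" for a b
      using U[of a b] that 4 rng by simp
    show ?thesis
      using U'[of 0 0] U'[of 0 1] U'[of 0 "-1"] U'[of 1 0] U'[of "-1" 0] U'[of 1 1] U'[of "-1" "-1"]
        h(2)[of p] h(2)[of "p + 1"] h(2)[of "p - 1"] 4 rng
      by (simp add: balanced_def)
  next
    case 5
    \<comment> \<open>The bound \<open>b \<le> a + 1\<close> excludes only \<open>(-1, 1)\<close>,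
      which is not a neighbor direction, and keeps the point in the closed triangle.\<close>
    have U': "?U (x + a) (y + b) = ?h (p + a) (s + b)"
      if "a \<in> {-1, 0, 1}" "b \<in> {-1, 0, 1}" "b \<le> a + 1" for a b
    proof -
      have "s + b \<le> p + a" using that 5 by auto
      then show ?thesis using U[of a b] that 5 rng by (auto simp: max_absorb1 min_absorb2)
    qed
    have "balanced ?h p s" using 5 rng by (intro h(4))
    then show ?thesis
      using U'[of 0 0] U'[of 0 1] U'[of 0 "-1"] U'[of 1 0] U'[of "-1" 0] U'[of 1 1] U'[of "-1" "-1"]
      by (simp add: balanced_def)
  next
    case 6
    have U': "?U (x + a) (y + b) = ?h (s + b) (p + a)"
      if "a \<in> {-1, 0, 1}" "b \<in> {-1, 0, 1}" "a \<le> b + 1" for a b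
    proof -
      have "p + a \<le> s + b" using that 6 by auto
      then show ?thesis using U[of a b] that 6 rng by (auto simp: max_absorb2 min_absorb1)
    qed
    \<comment> \<open>Swapping the coordinates permutes the neighbor directions.\<close>
    have "?U x y = ?h s p" "?U x (y - 1) = ?h (s - 1) p" "?U x (y + 1) = ?h (s + 1) p"
      "?U (x - 1) (y - 1) = ?h (s - 1) (p - 1)" "?U (x - 1) y = ?h s (p - 1)"
      "?U (x + 1) y = ?h s (p + 1)" "?U (x + 1) (y + 1) = ?h (s + 1) (p + 1)"
      using U'[of 0 0] U'[of 0 1] U'[of 0 "-1"] U'[of 1 0] U'[of "-1" 0] U'[of 1 1] U'[of "-1" "-1"]
      by simp_all
    moreover have "balanced ?h s p" using 6 rng by (intro h(4))
    ultimately show ?thesis by (simp only: balanced_def ac_simps)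
  qed
qed

lemma null_pattern_unfold: "null_pattern (L * m) (unfold_pattern L f)"
  unfolding null_pattern_def using unfold_pattern_mirror balanced_unfold_pattern by auto

end

theorem theorem1:
  fixes n j :: nat
  assumes "n \<ge> 1"
    and "nontrivial_kernel n"
    and "j \<ge> 1"
  shows "nontrivial_kernel (n + (n + 2) * j)"
proof -
  let ?L = "int n + 2"
  obtain f p s where f: "null_pattern ?L f" and ps: "0 < s" "s < p" "p < ?L" "f p s"
    using assms(2) by (auto simp: nontrivial_kernel_iff_null_pattern)
  have size: "int (n + (n + 2) * j) + 2 = ?L * (int j + 1)"
    by (simp add: algebra_simps)
  \<comment> \<open>The original triangle has colour 0, so the unfolded pattern extends
    \<open>f\<close> and is non-empty.\<close>
  have "unfold_pattern ?L f p s"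
    using unfold_pattern_rhombus[OF _ f, of p s 0 0] ps by (simp add: rotated_0)
  moreover have "p < ?L * (int j + 1)"
  proof -
    have "?L * 1 \<le> ?L * (int j + 1)" by (intro mult_left_mono) auto
    then have "?L \<le> ?L * (int j + 1)" by (simp only: mult_1_right)
    with ps(3) show ?thesis by (rule less_le_trans)
  qed
  moreover have "null_pattern (?L * (int j + 1)) (unfold_pattern ?L f)"
    using null_pattern_unfold[OF _ f] by simp
  ultimately show ?thesis
    unfolding nontrivial_kernel_iff_null_pattern size using ps by blast
qed

end
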